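(* Let $n$ and $a$ be positive integers with $a^2\le n<(a+1)^2$, and let $K_n$ be the complete graph on $n$ vertices. Then: (i) $$\mathscr{D}_1(K_n)=\begin{cases} a+\frac{1}{2}(n-a^2) & \text{if } n\in\{a^2+2t: 0\le t\le a\},\\ 2a-1 & \text{if } n=a^2+1,\\ a+1+\frac{1}{2}\big((a+1)^2-n\big) & \text{if } n\in\{a^2+2t+1: 1\le t\le a-1\},\end{cases}$$ where $t$ ranges over integers; (ii) $$\mathscr{D}_2(K_n)=\left\lfloor \tfrac{n}{2}\right\rfloor .$$
   Context: All graphs are finite and simple. For a graph $G$ and a labelling $f: V(G)\to\{0,1\}$, the induced edge labelling is $\overline{f}(xy)=|f(x)-f(y)|$ for $xy\in E(G)$. For $i\in\{0,1\}$, $v_i(f)$ is the number of vertices with label $i$ and $e_i(f)$ is the number of edges with induced label $i$. Put $\Delta_v(f)=|v_0(f)-v_1(f)|$ and $\Delta_e(f)=|e_0(f)-e_1(f)|$. Define $$\mathscr{D}_1(G)=\min_{f}\{\Delta_v(f)+\Delta_e(f)\},\qquad \mathscr{D}_2(G)=\min_{f:\,\Delta_v(f)\le 1}\{\Delta_e(f)\},$$ where the first minimum is over all labellings $f:V(G)\to\{0,1\}$ and the second is over those with $\Delta_v(f)\le 1$. *)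

theory Defs
  imports Complex_Main "HOL-Library.FuncSet"
begin

record 'a graph =
  verts :: "'a set"
  edges :: "'a set set"

definition finite_simple_graph :: "'a graph \<Rightarrow> bool" where
  "finite_simple_graph G \<longleftrightarrow> finite (verts G) \<and>
     (\<forall>e\<in>edges G. \<exists>x\<in>verts G. \<exists>y\<in>verts G. x \<noteq> y \<and> e = {x, y})"

definition complete_graph :: "'a set \<Rightarrow> 'a graph" where
  "complete_graph V =
     \<lparr>verts = V, edges = {{x, y} | x y. x \<in> V \<and> y \<in> V \<and> x \<noteq> y}\<rparr>"

lemma finite_simple_graph_complete_graph:
  "finite V \<Longrightarrow> finite_simple_graph (complete_graph V)"
  by (fastforce simp: finite_simple_graph_def complete_graph_def)

text \<open>Labellings are functions on the vertex set only (\<^const>\<open>PiE\<close>, not \<^const>\<open>Pi\<close>),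
  so that a finite graph has finitely many of them. Labels are integers, so that the
  differences below are not truncated.\<close>

definition labellings :: "'a graph \<Rightarrow> ('a \<Rightarrow> int) set" where
  "labellings G = verts G \<rightarrow>\<^sub>E {0, 1}"

definition induced_label :: "('a \<Rightarrow> int) \<Rightarrow> 'a set \<Rightarrow> int" where
  "induced_label f e = (THE k. \<exists>x y. e = {x, y} \<and> k = \<bar>f x - f y\<bar>)"

lemma induced_label_edge: "induced_label f {x, y} = \<bar>f x - f y\<bar>"
  unfolding induced_label_def by (rule the_equality) (auto simp: doubleton_eq_iff)

definition vcount :: "'a graph \<Rightarrow> ('a \<Rightarrow> int) \<Rightarrow> int \<Rightarrow> nat" where
  "vcount G f i = card {x \<in> verts G. f x = i}"

definition ecount :: "'a graph \<Rightarrow> ('a \<Rightarrow> int) \<Rightarrow> int \<Rightarrow> nat" where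
  "ecount G f i = card {e \<in> edges G. induced_label f e = i}"

definition Delta_v :: "'a graph \<Rightarrow> ('a \<Rightarrow> int) \<Rightarrow> int" where
  "Delta_v G f = \<bar>int (vcount G f 0) - int (vcount G f 1)\<bar>"

definition Delta_e :: "'a graph \<Rightarrow> ('a \<Rightarrow> int) \<Rightarrow> int" where
  "Delta_e G f = \<bar>int (ecount G f 0) - int (ecount G f 1)\<bar>"

definition D1 :: "'a graph \<Rightarrow> int" where
  "D1 G = Min ((\<lambda>f. Delta_v G f + Delta_e G f) ` labellings G)"

definition D2 :: "'a graph \<Rightarrow> int" where
  "D2 G = Min (Delta_e G ` {f \<in> labellings G. Delta_v G f \<le> 1})"

text \<open>Both minima are over finite nonempty sets.\<close>

lemma finite_labellings: "finite_simple_graph G \<Longrightarrow> finite (labellings G)"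
  by (simp add: labellings_def finite_simple_graph_def finite_PiE)

lemma labellings_nonempty: "labellings G \<noteq> {}"
  by (simp add: labellings_def PiE_eq_empty_iff)

lemma balanced_labelling_exists:
  assumes "finite_simple_graph G"
  shows "{f \<in> labellings G. Delta_v G f \<le> 1} \<noteq> {}"
proof -
  have fin: "finite (verts G)"
    using assms by (simp add: finite_simple_graph_def)
  obtain A where A: "A \<subseteq> verts G" "card A = card (verts G) div 2"
    using obtain_subset_with_card_n[of "card (verts G) div 2" "verts G"] by auto
  define f where "f = (\<lambda>x\<in>verts G. if x \<in> A then 1 else 0 :: int)"
  have "{x \<in> verts G. f x = 1} = A" "{x \<in> verts G. f x = 0} = verts G - A"
    using A(1) by (auto simp: f_def)
  then have "vcount G f 1 = card (verts G) div 2"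
    "vcount G f 0 = card (verts G) - card (verts G) div 2"
    using A fin by (simp_all add: vcount_def card_Diff_subset finite_subset)
  then have "Delta_v G f \<le> 1"
    unfolding Delta_v_def by linarith
  moreover have "f \<in> labellings G"
    by (auto simp: f_def labellings_def)
  ultimately show ?thesis by blast
qed

end

theory Submission
  imports Defs
begin

text \<open>
  On a complete graph both discrepancies depend only on \<open>d = Delta_v\<close>. The edges with
  label \<open>1\<close> are the pairs joining the two label classes, so there are
  \<open>v\<^sub>0 v\<^sub>1 = (n\<^sup>2 - d\<^sup>2) / 4\<close> of them among \<open>n (n - 1) / 2\<close> edges, which gives
  \<open>2 Delta_e = \<bar>d\<^sup>2 - n\<bar>\<close> (\<open>two_Delta_e_complete_graph\<close>). The possible values of \<open>d\<close> are
  exactly the integers \<open>0 \<le> d \<le> n\<close> with the parity of \<open>n\<close> (\<open>Delta_v_bounds\<close>,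
  \<open>ex_labelling_Delta_v\<close>).
  Hence \<open>D2\<close> is read off at the only balanced value, \<open>d = n mod 2\<close>, and \<open>D1\<close> is the
  minimum of \<open>d + \<bar>d\<^sup>2 - n\<bar> / 2\<close> over the integers just described.

  This function increases where \<open>d\<^sup>2 \<ge> n\<close>. Where \<open>d\<^sup>2 \<le> n\<close> it is a concave parabola with
  its peak at \<open>d = 1\<close>; since it takes the same value at \<open>0\<close> and \<open>2\<close>, it never increases along
  the natural numbers of one parity (\<open>cost_below\<close>, \<open>cost_above\<close>). The minimum is therefore at
  the last integer of the right parity up to \<open>\<surd>n\<close> or at the next one: these are \<open>a\<close> and
  \<open>a + 2\<close> when \<open>n - a\<^sup>2\<close> is even, and there \<open>a\<close> wins, and \<open>a - 1\<close> and \<open>a + 1\<close> when \<open>n - a\<^sup>2\<close>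
  is odd. In the last case the costs at \<open>n = a\<^sup>2 + 2 t + 1\<close> are \<open>2 a - 1 + t\<close> and
  \<open>2 a + 1 - t\<close>, so \<open>a - 1\<close> is strictly cheaper only for \<open>t = 0\<close>, which is why
  \<open>n = a\<^sup>2 + 1\<close> is exceptional.
\<close>

section \<open>Edge discrepancy of a labelling of a complete graph\<close>

lemma edges_complete_graph: "edges (complete_graph V) = {e. e \<subseteq> V \<and> card e = 2}"
  by (auto simp: complete_graph_def card_2_iff)

lemma vcount_0_plus_vcount_1:
  assumes "finite V" "f \<in> labellings (complete_graph V)"
  shows "vcount (complete_graph V) f 0 + vcount (complete_graph V) f 1 = card V"
proof -
  have "V = {x \<in> V. f x = 0} \<union> {x \<in> V. f x = 1}"
    using assms(2) by (auto simp: labellings_def complete_graph_def PiE_iff)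
  moreover have "card ({x \<in> V. f x = 0} \<union> {x \<in> V. f x = 1})
      = card {x \<in> V. f x = 0} + card {x \<in> V. f x = 1}"
    using assms(1) by (intro card_Un_disjoint) auto
  ultimately show ?thesis
    by (simp add: vcount_def complete_graph_def)
qed

lemma ecount_1_complete_graph:
  assumes "f \<in> labellings (complete_graph V)"
  shows "ecount (complete_graph V) f 1
    = vcount (complete_graph V) f 0 * vcount (complete_graph V) f 1"
proof -
  let ?A = "{x \<in> V. f x = 0}" and ?B = "{x \<in> V. f x = 1}"
  have f01: "f x = 0 \<or> f x = 1" if "x \<in> V" for x
    using assms that by (auto simp: labellings_def complete_graph_def PiE_iff)
  have "{e \<in> edges (complete_graph V). induced_label f e = 1} = (\<lambda>(x, y). {x, y}) ` (?A \<times> ?B)"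
  proof (intro equalityI subsetI)
    fix e assume "e \<in> {e \<in> edges (complete_graph V). induced_label f e = 1}"
    then obtain x y where e: "e = {x, y}" "x \<in> V" "y \<in> V" "\<bar>f x - f y\<bar> = 1"
      by (auto simp: complete_graph_def induced_label_edge)
    then have "(x, y) \<in> ?A \<times> ?B \<or> (y, x) \<in> ?A \<times> ?B"
      using f01[of x] f01[of y] by auto
    then show "e \<in> (\<lambda>(x, y). {x, y}) ` (?A \<times> ?B)"
      using e(1) by (force simp: insert_commute)
  next
    fix e assume "e \<in> (\<lambda>(x, y). {x, y}) ` (?A \<times> ?B)"
    then obtain x y where e: "e = {x, y}" "x \<in> V" "y \<in> V" "f x = 0" "f y = 1"
      by auto
    then have "x \<noteq> y"
      by auto
    then have "e \<in> edges (complete_graph V)"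
      using e(1-3) by (auto simp: complete_graph_def)
    then show "e \<in> {e \<in> edges (complete_graph V). induced_label f e = 1}"
      using e by (simp add: induced_label_edge)
  qed
  moreover have "inj_on (\<lambda>(x, y). {x, y}) (?A \<times> ?B)"
    by (auto simp: inj_on_def doubleton_eq_iff)
  ultimately show ?thesis
    by (simp add: ecount_def vcount_def card_image card_cartesian_product)
      (simp add: complete_graph_def)
qed

lemma ecount_0_plus_ecount_1:
  assumes "finite V" "f \<in> labellings (complete_graph V)"
  shows "ecount (complete_graph V) f 0 + ecount (complete_graph V) f 1 = card V choose 2"
proof -
  let ?E = "edges (complete_graph V)"
  let ?Z = "{e \<in> ?E. induced_label f e = 0}" and ?O = "{e \<in> ?E. induced_label f e = 1}"
  have f01: "f x = 0 \<or> f x = 1" if "x \<in> V" for x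
    using assms(2) that by (auto simp: labellings_def complete_graph_def PiE_iff)
  have "induced_label f e = 0 \<or> induced_label f e = 1" if e: "e \<in> ?E" for e
  proof -
    obtain x y where "e = {x, y}" "x \<in> V" "y \<in> V"
      using e by (auto simp: complete_graph_def)
    then show ?thesis
      using f01[of x] f01[of y] by (auto simp: induced_label_edge)
  qed
  then have "?E = ?Z \<union> ?O"
    by blast
  moreover have "finite ?E"
    using assms(1) by (simp add: edges_complete_graph)
  then have "card (?Z \<union> ?O) = card ?Z + card ?O"
    by (intro card_Un_disjoint) auto
  moreover have "card ?E = card V choose 2"
    using n_subsets[OF assms(1)] by (simp add: edges_complete_graph)
  ultimately show ?thesis
    by (simp add: ecount_def)
qed

text \<open>With class sizes \<open>p\<close> and \<open>q\<close>, the identity behind this is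
  \<open>(p + q) (p + q - 1) - 4 p q = (p - q)\<^sup>2 - (p + q)\<close>.\<close>

lemma two_Delta_e_complete_graph:
  assumes "finite V" "f \<in> labellings (complete_graph V)"
  shows "2 * Delta_e (complete_graph V) f
    = \<bar>(Delta_v (complete_graph V) f)\<^sup>2 - int (card V)\<bar>"
proof -
  define p q where "p = vcount (complete_graph V) f 0" and "q = vcount (complete_graph V) f 1"
  define r s where "r = ecount (complete_graph V) f 0" and "s = ecount (complete_graph V) f 1"
  have n: "int (card V) = int p + int q"
    using vcount_0_plus_vcount_1[OF assms] by (simp add: p_def q_def flip: of_nat_add)
  have "2 * (r + s) = card V * (card V - 1)"
    using ecount_0_plus_ecount_1[OF assms] times_binomial_minus1_eq[of 2 "card V"]
    by (simp add: r_def s_def)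
  then have "int (2 * (r + s)) = int (card V) * (int (card V) - 1)"
    by (cases "card V") (simp_all add: algebra_simps)
  moreover have "int s = int p * int q"
    using ecount_1_complete_graph[OF assms(2)] by (simp add: p_def q_def s_def)
  ultimately have "2 * (int r - int s) = (int p - int q)\<^sup>2 - int (card V)"
    unfolding n by (simp add: power2_eq_square algebra_simps)
  then have "\<bar>2 * (int r - int s)\<bar> = \<bar>(int p - int q)\<^sup>2 - int (card V)\<bar>"
    by simp
  then show ?thesis
    unfolding Delta_e_def Delta_v_def p_def q_def r_def s_def by (simp only: abs_mult) simp
qed

section \<open>Possible vertex discrepancies\<close>

lemma Delta_v_bounds:
  assumes "finite V" "f \<in> labellings (complete_graph V)"
  shows "0 \<le> Delta_v (complete_graph V) f"
    and "Delta_v (complete_graph V) f \<le> int (card V)"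
    and "even (int (card V) + Delta_v (complete_graph V) f)"
proof -
  define p q where "p = vcount (complete_graph V) f 0" and "q = vcount (complete_graph V) f 1"
  have *: "int (card V) = int p + int q" "Delta_v (complete_graph V) f = \<bar>int p - int q\<bar>"
    using vcount_0_plus_vcount_1[OF assms]
    by (simp_all add: p_def q_def Delta_v_def flip: of_nat_add)
  show "0 \<le> Delta_v (complete_graph V) f" "Delta_v (complete_graph V) f \<le> int (card V)"
    unfolding * by linarith+
  show "even (int (card V) + Delta_v (complete_graph V) f)"
    unfolding * by (auto simp: abs_if)
qed

lemma ex_labelling_Delta_v:
  assumes "finite V" "0 \<le> d" "d \<le> int (card V)" "even (int (card V) + d)"
  obtains f where "f \<in> labellings (complete_graph V)" "Delta_v (complete_graph V) f = d"
proof -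
  define k where "k = nat ((int (card V) - d) div 2)"
  have k: "int (card V) - 2 * int k = d" "k \<le> card V"
  proof -
    obtain j where j: "int (card V) - d = 2 * j"
      using assms(4) by (metis dvdE even_add even_diff)
    then show "int (card V) - 2 * int k = d" "k \<le> card V"
      using assms(2,3) by (simp_all add: k_def)
  qed
  obtain A where A: "A \<subseteq> V" "card A = k"
    using obtain_subset_with_card_n[OF k(2)] by auto
  define f where "f = (\<lambda>x\<in>V. if x \<in> A then 1 else 0 :: int)"
  have "f \<in> labellings (complete_graph V)"
    by (auto simp: f_def labellings_def complete_graph_def)
  moreover have "{x \<in> V. f x = 1} = A"
    using A(1) by (auto simp: f_def)
  then have "vcount (complete_graph V) f 1 = k"
    using A(2) by (simp add: vcount_def complete_graph_def)
  then have "Delta_v (complete_graph V) f = d"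
    using vcount_0_plus_vcount_1[OF assms(1) calculation] k(1) assms(2)
    unfolding Delta_v_def by linarith
  ultimately show thesis
    by (rule that)
qed

section \<open>Reduction to minimising an integer function\<close>

lemma D1_complete_graph_eqI:
  assumes V: "finite V" "card V = n"
    and d: "0 \<le> d" "d \<le> int n" "even (int n + d)" "2 * m = 2 * d + \<bar>d\<^sup>2 - int n\<bar>"
    and le: "\<And>k. \<lbrakk>0 \<le> k; even (int n + k)\<rbrakk> \<Longrightarrow> 2 * m \<le> 2 * k + \<bar>k\<^sup>2 - int n\<bar>"
  shows "D1 (complete_graph V) = m"
  unfolding D1_def
proof (rule Min_eqI)
  let ?G = "complete_graph V"
  show "finite ((\<lambda>f. Delta_v ?G f + Delta_e ?G f) ` labellings ?G)"
    by (intro finite_imageI finite_labellings finite_simple_graph_complete_graph V)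
  show "m \<le> y" if y: "y \<in> (\<lambda>f. Delta_v ?G f + Delta_e ?G f) ` labellings ?G" for y
  proof -
    obtain f where f: "f \<in> labellings ?G" "y = Delta_v ?G f + Delta_e ?G f"
      using y by blast
    then show ?thesis
      using le[of "Delta_v ?G f"] Delta_v_bounds[OF V(1) f(1)]
        two_Delta_e_complete_graph[OF V(1) f(1)] V(2) by simp
  qed
  obtain f where f: "f \<in> labellings ?G" "Delta_v ?G f = d"
    using ex_labelling_Delta_v[of V d] V d by metis
  have "m = Delta_v ?G f + Delta_e ?G f"
    using two_Delta_e_complete_graph[OF V(1) f(1)] f(2) V(2) d(4) by simp
  then show "m \<in> (\<lambda>f. Delta_v ?G f + Delta_e ?G f) ` labellings ?G"
    using f(1) by blast
qed

text \<open>Parity leaves only \<open>Delta_v = n mod 2\<close> for a balanced labelling, so all of these have the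
  same \<open>Delta_e\<close>.\<close>

lemma D2_complete_graph:
  assumes V: "finite V"
  shows "D2 (complete_graph V) = int (card V div 2)"
proof -
  let ?G = "complete_graph V"
  let ?B = "{f \<in> labellings ?G. Delta_v ?G f \<le> 1}"
  have "Delta_e ?G f = int (card V div 2)" if "f \<in> ?B" for f
  proof -
    have f: "f \<in> labellings ?G" "Delta_v ?G f \<le> 1"
      using that by auto
    then have "Delta_v ?G f = 0 \<or> Delta_v ?G f = 1"
      using Delta_v_bounds(1)[OF V f(1)] by linarith
    then have "Delta_v ?G f = 0 \<and> even (card V) \<or> Delta_v ?G f = 1 \<and> odd (card V)"
      using Delta_v_bounds(3)[OF V f(1)] by auto
    then show ?thesis
      using two_Delta_e_complete_graph[OF V f(1)] by (auto elim!: evenE oddE)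
  qed
  moreover have "?B \<noteq> {}"
    using V by (intro balanced_labelling_exists finite_simple_graph_complete_graph)
  ultimately have "Delta_e ?G ` ?B = {int (card V div 2)}"
    by (auto simp: image_iff)
  then show ?thesis
    by (simp add: D2_def)
qed

section \<open>Monotonicity of the cost on either side of the square root\<close>

text \<open>The difference of \<open>2 k - k\<^sup>2\<close> and \<open>2 b - b\<^sup>2\<close> is \<open>(b - k) (b + k - 2)\<close>. By
  parity \<open>k < b\<close> forces \<open>b \<ge> 2\<close> when \<open>k = 0\<close>, so the second factor is negative only if the
  first one vanishes.\<close>

lemma cost_below:
  fixes k b n :: int
  assumes "0 \<le> k" "k \<le> b" "even (b + k)"
  shows "2 * b + n - b\<^sup>2 \<le> 2 * k + \<bar>k\<^sup>2 - n\<bar>"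
proof -
  have "k = b \<or> k + 2 \<le> b"
    using assms by presburger
  then have "0 \<le> (b - k) * (b + k - 2)"
    using assms(1) by auto
  then have "2 * b - b\<^sup>2 \<le> 2 * k - k\<^sup>2"
    by (simp add: power2_eq_square algebra_simps)
  then show ?thesis
    by linarith
qed

lemma cost_above:
  fixes k b n :: int
  assumes "0 \<le> b" "b \<le> k"
  shows "2 * b + b\<^sup>2 - n \<le> 2 * k + \<bar>k\<^sup>2 - n\<bar>"
  using power_mono[OF assms(2,1), of 2] assms(2) by linarith

section \<open>The discrepancies of complete graphs\<close>

lemma D1_complete_graph_same_parity:
  assumes V: "finite V" "card V = a\<^sup>2 + 2 * t" and "t \<le> a"
  shows "D1 (complete_graph V) = int a + int t"
proof (rule D1_complete_graph_eqI[OF V, where d = "int a"])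
  show "int a \<le> int (a\<^sup>2 + 2 * t)"
    using le_square[of a] unfolding power2_eq_square by linarith
  show "2 * (int a + int t) \<le> 2 * k + \<bar>k\<^sup>2 - int (a\<^sup>2 + 2 * t)\<bar>"
    if "0 \<le> k" "even (int (a\<^sup>2 + 2 * t) + k)" for k
  proof -
    have par: "even (int a + k)"
      using that(2) by simp
    show ?thesis
    proof (cases "k \<le> int a")
      case True
      then show ?thesis
        using cost_below[OF that(1) True par, of "int (a\<^sup>2 + 2 * t)"] by simp
    next
      case False
      then have "int a + 2 \<le> k"
        using par by presburger
      then show ?thesis
        using cost_above[of "int a + 2" k "int (a\<^sup>2 + 2 * t)"] \<open>t \<le> a\<close>
        by (simp add: power2_eq_square algebra_simps)
    qed
  qed
qed auto

text \<open>For \<open>0 \<le> t < a\<close> the two arguments of \<open>min\<close> are the doubled costs at \<open>a - 1\<close> and at \<open>a + 1\<close>,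
  the neighbours of \<open>\<surd>(a\<^sup>2 + 2 t + 1)\<close> of this parity.\<close>

lemma cost_opposite_parity:
  fixes a t k :: int
  assumes "0 < a" "0 \<le> k" "odd (a + k)"
  shows "min (2 * (2 * a - 1 + t)) (2 * (2 * a + 1 - t)) \<le> 2 * k + \<bar>k\<^sup>2 - (a\<^sup>2 + 2 * t + 1)\<bar>"
proof (cases "k \<le> a - 1")
  case True
  have "even (a - 1 + k)"
    using assms(3) by simp
  from cost_below[OF assms(2) True this, of "a\<^sup>2 + 2 * t + 1"] show ?thesis
    by (simp add: power2_eq_square algebra_simps)
next
  case False
  then have "a + 1 \<le> k"
    using assms(3) by presburger
  then show ?thesis
    using cost_above[of "a + 1" k "a\<^sup>2 + 2 * t + 1"] assms(1)
    by (simp add: power2_eq_square algebra_simps)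
qed

lemma D1_complete_graph_square_plus_1:
  assumes V: "finite V" "card V = a\<^sup>2 + 1" and "a > 0"
  shows "D1 (complete_graph V) = 2 * int a - 1"
proof (rule D1_complete_graph_eqI[OF V, where d = "int a - 1"])
  show "int a - 1 \<le> int (a\<^sup>2 + 1)"
    using le_square[of a] unfolding power2_eq_square by linarith
  show "2 * (2 * int a - 1) = 2 * (int a - 1) + \<bar>(int a - 1)\<^sup>2 - int (a\<^sup>2 + 1)\<bar>"
    using \<open>a > 0\<close> by (simp add: power2_eq_square algebra_simps)
  show "2 * (2 * int a - 1) \<le> 2 * k + \<bar>k\<^sup>2 - int (a\<^sup>2 + 1)\<bar>"
    if "0 \<le> k" "even (int (a\<^sup>2 + 1) + k)" for k
    using cost_opposite_parity[of "int a" k 0] that \<open>a > 0\<close> by (simp add: add_ac)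
qed (use \<open>a > 0\<close> in auto)

lemma D1_complete_graph_opposite_parity:
  assumes V: "finite V" "card V = a\<^sup>2 + 2 * t + 1" and "1 \<le> t" "t \<le> a"
  shows "D1 (complete_graph V) = 2 * int a + 1 - int t"
proof (rule D1_complete_graph_eqI[OF V, where d = "int a + 1"])
  show "int a + 1 \<le> int (a\<^sup>2 + 2 * t + 1)"
    using le_square[of a] assms(3) unfolding power2_eq_square by linarith
  show "2 * (2 * int a + 1 - int t)
      = 2 * (int a + 1) + \<bar>(int a + 1)\<^sup>2 - int (a\<^sup>2 + 2 * t + 1)\<bar>"
    using \<open>t \<le> a\<close> by (simp add: power2_eq_square algebra_simps)
  show "2 * (2 * int a + 1 - int t) \<le> 2 * k + \<bar>k\<^sup>2 - int (a\<^sup>2 + 2 * t + 1)\<bar>"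
    if "0 \<le> k" "even (int (a\<^sup>2 + 2 * t + 1) + k)" for k
    using cost_opposite_parity[of "int a" k "int t"] that assms(3,4) by (simp add: add_ac)
qed auto

theorem theorem4p1:
  fixes n a :: nat and V :: "'a set"
  assumes "n > 0" and "a > 0"
    and "a ^ 2 \<le> n" and "n < (a + 1) ^ 2"
    and "finite V" and "card V = n"
  shows "(n \<in> {a ^ 2 + 2 * t | t. 0 \<le> t \<and> t \<le> a}
            \<or> n = a ^ 2 + 1
            \<or> n \<in> {a ^ 2 + 2 * t + 1 | t. 1 \<le> t \<and> t \<le> a - 1})
         \<and> (n \<in> {a ^ 2 + 2 * t | t. 0 \<le> t \<and> t \<le> a} \<longrightarrow>
              real_of_int (D1 (complete_graph V)) = real a + 1 / 2 * (real n - real a ^ 2))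
         \<and> (n = a ^ 2 + 1 \<longrightarrow>
              D1 (complete_graph V) = 2 * int a - 1)
         \<and> (n \<in> {a ^ 2 + 2 * t + 1 | t. 1 \<le> t \<and> t \<le> a - 1} \<longrightarrow>
              real_of_int (D1 (complete_graph V)) =
                real a + 1 + 1 / 2 * ((real a + 1) ^ 2 - real n))
         \<and> D2 (complete_graph V) = \<lfloor>real n / 2\<rfloor>"
proof (intro conjI impI)
  show "n \<in> {a ^ 2 + 2 * t | t. 0 \<le> t \<and> t \<le> a} \<or> n = a ^ 2 + 1
      \<or> n \<in> {a ^ 2 + 2 * t + 1 | t. 1 \<le> t \<and> t \<le> a - 1}"
  proof -
    define r where "r = n - a\<^sup>2"
    have r: "n = a\<^sup>2 + r" "r \<le> 2 * a"
      using assms(3,4) by (auto simp: r_def power2_eq_square)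
    show ?thesis
    proof (cases "even r")
      case True
      then show ?thesis
        using r by (auto elim!: evenE)
    next
      case False
      then obtain t where t: "r = 2 * t + 1"
        by (auto elim: oddE)
      have "t = 0 \<or> 1 \<le> t \<and> t \<le> a - 1"
        using r(2) t by linarith
      then show ?thesis
        using r(1) t by auto
    qed
  qed
next
  assume "n \<in> {a ^ 2 + 2 * t | t. 0 \<le> t \<and> t \<le> a}"
  then obtain t where "n = a\<^sup>2 + 2 * t" "t \<le> a"
    by blast
  then show "real_of_int (D1 (complete_graph V)) = real a + 1 / 2 * (real n - real a ^ 2)"
    using D1_complete_graph_same_parity[of V a t] assms(5,6) by simp
next
  assume "n = a ^ 2 + 1"
  then show "D1 (complete_graph V) = 2 * int a - 1"
    using D1_complete_graph_square_plus_1[of V a] assms(2,5,6) by simp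
next
  assume "n \<in> {a ^ 2 + 2 * t + 1 | t. 1 \<le> t \<and> t \<le> a - 1}"
  then obtain t where "n = a\<^sup>2 + 2 * t + 1" "1 \<le> t" "t \<le> a"
    by auto
  then show "real_of_int (D1 (complete_graph V)) =
      real a + 1 + 1 / 2 * ((real a + 1) ^ 2 - real n)"
    using D1_complete_graph_opposite_parity[of V a t] assms(5,6)
    by (simp add: power2_eq_square field_simps)
next
  show "D2 (complete_graph V) = \<lfloor>real n / 2\<rfloor>"
    using D2_complete_graph[OF assms(5)] floor_divide_of_nat_eq[of n 2, where ?'a = real] assms(6)
    by simp
qed

end
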